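(* For arbitrary positive integers $m$ and $n$, the following identity holds in the field of rational functions $\mathbb{Q}(x_1,\ldots,x_n)$: $$\sum_{\lambda\subseteq \{m^n\}} s_{\lambda}(x_1,\ldots,x_n) = \frac{\det\big(x_i^{j-1}-x_i^{m+2n-j}\big)_{1\le i,j\le n}}{\det\big(x_i^{j-1}-x_i^{2n-j}\big)_{1\le i,j\le n}},$$ where the sum runs over all partitions $\lambda=(\lambda_1\ge \lambda_2\ge\cdots\ge\lambda_n\ge 0)$ with at most $n$ (nonzero) parts, each part at most $m$.
   Context: For a partition $\lambda=(\lambda_1\ge\cdots\ge\lambda_n\ge0)$, the Schur function in $n$ variables is $s_\lambda(x_1,\ldots,x_n)=\det\big(x_i^{\lambda_j+n-j}\big)_{1\le i,j\le n}\big/\prod_{1\le i<j\le n}(x_i-x_j)$ (equivalently, the sum over semistandard Young tableaux of shape $\lambda$ with entries in $\{1,\ldots,n\}$ of the corresponding monomials). The notation $\lambda\subseteq\{m^n\}$ means the Young diagram of $\lambda$ fits inside an $n\times m$ rectangle, i.e. $\lambda$ has at most $n$ parts and $\lambda_1\le m$. *)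

theory Defs
  imports
    "HOL-Library.Poly_Mapping"
    "HOL-Computational_Algebra.Fraction_Field"
    "Jordan_Normal_Form.Determinant"
begin

text \<open>
  A monomial is a finitely supported exponent vector and a polynomial is a finitely supported
  family of rational coefficients of monomials. The variables are indexed by all natural numbers,
  so \<open>ratfun\<close> is the field of rational functions in countably many variables; for each \<open>n\<close> it
  contains the field of rational functions in \<open>x\<^sub>1, \<dots>, x\<^sub>n\<close> as a subfield.
\<close>

type_synonym ratfun = "((nat \<Rightarrow>\<^sub>0 nat) \<Rightarrow>\<^sub>0 rat) fract"

definition X :: "nat \<Rightarrow> ratfun" where
  "X i = Fract (Poly_Mapping.single (Poly_Mapping.single i 1) 1) 1"

text \<open>The determinant with rows and columns indexed by \<open>1, \<dots>, n\<close> instead of \<open>0, \<dots>, n - 1\<close>.\<close>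

definition det1 :: "nat \<Rightarrow> (nat \<Rightarrow> nat \<Rightarrow> 'a) \<Rightarrow> 'a :: comm_ring_1" where
  "det1 n a = det (mat n n (\<lambda>(i, j). a (Suc i) (Suc j)))"

text \<open>
  A partition with at most \<open>n\<close> nonzero parts is a list of length exactly \<open>n\<close>, padded with zeros,
  and \<open>part \<lambda> j\<close> is \<open>\<lambda>\<^sub>j\<close> for \<open>1 \<le> j \<le> n\<close>.
\<close>

definition part :: "nat list \<Rightarrow> nat \<Rightarrow> nat" where
  "part lam j = lam ! (j - 1)"

definition box_partitions :: "nat \<Rightarrow> nat \<Rightarrow> nat list set" where
  "box_partitions m n = {lam. length lam = n \<and> sorted_wrt (\<ge>) lam \<and> (\<forall>k \<in> set lam. k \<le> m)}"

text \<open>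
  The bialternant formula. It gives the value of the Schur function only at pairwise distinct
  \<open>x 1, \<dots>, x n\<close>; otherwise the denominator vanishes.
\<close>

definition schur :: "nat \<Rightarrow> (nat \<Rightarrow> 'a) \<Rightarrow> nat list \<Rightarrow> 'a :: field" where
  "schur n x lam =
     det1 n (\<lambda>i j. x i ^ (part lam j + n - j)) /
     (\<Prod>(i, j) \<in> {(i, j). 1 \<le> i \<and> i < j \<and> j \<le> n}. x i - x j)"

end

theory Submission
  imports Defs
begin

text \<open>
  Expanding the determinant with exponent \<open>N = m + n\<close> row by row gives a sum of \<open>2\<^sup>n\<close>
  Vandermonde determinants in which the variables indexed by a set \<open>S\<close> are inverted. Up to a
  nonzero factor that does not depend on \<open>N\<close> it is \<open>H\<^sub>N(I) = \<Sum>S\<subseteq>I. (\<Prod>i\<in>S. x\<^sub>i\<^sup>N) w(S, I)\<close> for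
  \<open>I = {1, \<dots>, n}\<close>, where \<open>w(S, I)\<close> is a product over the points and the pairs of points of \<open>I\<close>.
  Lagrange interpolation of \<open>\<Prod>j\<in>S. (1 - x\<^sub>j z)\<close> at the nodes \<open>x\<^sub>i\<close> and \<open>-1\<close> yields
  \<open>H\<^sub>N\<^sub>+\<^sub>1(I) = H\<^sub>N(I) + \<Sum>i\<in>I. x\<^sub>i\<^sup>N H\<^sub>N(I - {i}) / \<Prod>j\<noteq>i. (x\<^sub>i - x\<^sub>j)\<close>.
  The sum of Schur functions satisfies the same recursion: split the partitions according to
  whether the largest part is equal to \<open>m\<close>, and expand the alternant along its first column.
  Moreover \<open>H\<^sub>n(I) = 1\<close>, so that the quotient of the two determinants is \<open>H\<^sub>m\<^sub>+\<^sub>n(I)\<close>.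
\<close>

section \<open>Products over pairs of indices\<close>

text \<open>Each pair is taken in increasing order, which fixes the sign of antisymmetric factors
  such as \<open>x i - x j\<close>. General index sets are allowed because the recursion deletes
  single points.\<close>

definition pairs_prod :: "(nat \<Rightarrow> nat \<Rightarrow> 'a :: comm_monoid_mult) \<Rightarrow> nat set \<Rightarrow> 'a" where
  "pairs_prod f I = (\<Prod>(i, j) \<in> {(i, j). i \<in> I \<and> j \<in> I \<and> i < j}. f i j)"

lemma finite_pairs: "finite I \<Longrightarrow> finite {(i, j). i \<in> I \<and> j \<in> I \<and> (i :: nat) < j}"
  by (rule finite_subset[of _ "I \<times> I"]) auto

lemma pairs_prod_cong:
  assumes "\<And>i j. i \<in> I \<Longrightarrow> j \<in> I \<Longrightarrow> i < j \<Longrightarrow> f i j = g i j"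
  shows "pairs_prod f I = pairs_prod g I"
  unfolding pairs_prod_def by (rule prod.cong) (auto simp: assms)

lemma pairs_prod_mult: "pairs_prod (\<lambda>i j. f i j * g i j) I = pairs_prod f I * pairs_prod g I"
  unfolding pairs_prod_def by (simp add: prod.distrib split_def)

lemma pairs_prod_nonzero:
  fixes f :: "nat \<Rightarrow> nat \<Rightarrow> 'a :: field"
  assumes "\<And>i j. i \<in> I \<Longrightarrow> j \<in> I \<Longrightarrow> i < j \<Longrightarrow> f i j \<noteq> 0"
  shows "pairs_prod f I \<noteq> 0"
proof (cases "finite {(i, j). i \<in> I \<and> j \<in> I \<and> i < j}")
  case True
  then show ?thesis using assms unfolding pairs_prod_def by auto
next
  case False
  then show ?thesis unfolding pairs_prod_def by simp
qed

lemma pairs_prod_reindex: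
  assumes "strict_mono s"
  shows "pairs_prod f (s ` I) = pairs_prod (\<lambda>i j. f (s i) (s j)) I"
proof -
  have eq: "{(i, j). i \<in> s ` I \<and> j \<in> s ` I \<and> i < j} =
      map_prod s s ` {(i, j). i \<in> I \<and> j \<in> I \<and> i < j}"
    using strict_mono_less[OF assms] by (auto simp: image_iff)
  have inj: "inj_on (map_prod s s) A" for A
    using strict_mono_eq[OF assms] by (auto simp: inj_on_def)
  show ?thesis
    unfolding pairs_prod_def eq by (subst prod.reindex[OF inj]) (simp add: split_def)
qed

text \<open>A pair in \<open>I\<close> either contains \<open>i\<close>, and then the other index
  ranges over \<open>I - {i}\<close>, or lies in \<open>I - {i}\<close>. As \<open>f\<close> may be
  asymmetric, \<open>min\<close> and \<open>max\<close> restore the order.\<close>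

lemma pairs_prod_remove:
  assumes "finite I" and "i \<in> I"
  shows "pairs_prod f I =
    (\<Prod>j\<in>I - {i}. f (min i j) (max i j)) * pairs_prod f (I - {i})"
proof -
  let ?h = "\<lambda>j. (min i j, max i j)"
  have eq: "{(a, b). a \<in> I \<and> b \<in> I \<and> a < b} =
      ?h ` (I - {i}) \<union> {(a, b). a \<in> I - {i} \<and> b \<in> I - {i} \<and> a < b}"
  proof (intro equalityI subsetI)
    fix p assume "p \<in> {(a, b). a \<in> I \<and> b \<in> I \<and> a < b}"
    then obtain a b where p: "p = (a, b)" "a \<in> I" "b \<in> I" "a < b" by auto
    consider "a = i" | "b = i" | "a \<noteq> i" "b \<noteq> i" by auto
    then show "p \<in> ?h ` (I - {i}) \<union> {(a, b). a \<in> I - {i} \<and> b \<in> I - {i} \<and> a < b}"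
    proof cases
      case 1
      then have "p = ?h b" "b \<in> I - {i}" using p by auto
      then show ?thesis by blast
    next
      case 2
      then have "p = ?h a" "a \<in> I - {i}" using p by auto
      then show ?thesis by blast
    qed (use p in auto)
  qed (use assms in \<open>auto simp: min_def max_def\<close>)
  have inj: "inj_on ?h (I - {i})"
    by (auto simp: inj_on_def min_def max_def split: if_splits)
  have "pairs_prod f I = prod (\<lambda>(a, b). f a b) (?h ` (I - {i})) * pairs_prod f (I - {i})"
    unfolding pairs_prod_def eq
    by (rule prod.union_disjoint)
      (use assms in \<open>auto simp: min_def max_def split: if_splits
          intro: finite_pairs[of "I - {i}", simplified]\<close>)
  also have "prod (\<lambda>(a, b). f a b) (?h ` (I - {i})) = (\<Prod>j\<in>I - {i}. f (min i j) (max i j))"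
    by (subst prod.reindex[OF inj]) simp
  finally show ?thesis .
qed

lemma pairs_prod_remove_commute:
  assumes "finite I" and "i \<in> I" and "\<And>j k. f j k = f k j"
  shows "pairs_prod f I = (\<Prod>j\<in>I - {i}. f i j) * pairs_prod f (I - {i})"
proof -
  have "f (min i j) (max i j) = f i j" for j
    using assms(3)[of j i] by (simp add: min_def max_def)
  then show ?thesis using pairs_prod_remove[OF assms(1,2), of f] by simp
qed

text \<open>Each point of \<open>I\<close> lies in exactly \<open>card I - 1\<close> pairs.\<close>

lemma pairs_prod_mult_points:
  fixes z :: "nat \<Rightarrow> 'a :: comm_monoid_mult"
  assumes "finite I"
  shows "pairs_prod (\<lambda>i j. z i * z j) I = (\<Prod>i\<in>I. z i ^ (card I - 1))"
  using assms
proof (induction I)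
  case empty
  then show ?case by (simp add: pairs_prod_def)
next
  case (insert i I)
  have "pairs_prod (\<lambda>i j. z i * z j) (insert i I) =
      (\<Prod>j\<in>I. z i * z j) * pairs_prod (\<lambda>i j. z i * z j) I"
    using pairs_prod_remove_commute[of "insert i I" i "\<lambda>i j. z i * z j"] insert.hyps
    by (simp add: mult.commute)
  also have "\<dots> = z i ^ card I * (\<Prod>j\<in>I. z j * z j ^ (card I - 1))"
    using insert by (simp add: prod.distrib mult.assoc)
  also have "(\<Prod>j\<in>I. z j * z j ^ (card I - 1)) = (\<Prod>j\<in>I. z j ^ card I)"
    using insert.hyps by (intro prod.cong refl) (metis card_gt_0_iff empty_iff power_eq_if neq0_conv)
  finally show ?case using insert.hyps by simp
qed

section \<open>Lagrange interpolation\<close>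

text \<open>The Lagrange interpolant \<open>L\<close> of \<open>p\<close> at the nodes
  \<open>T\<close> equals \<open>p\<close>, since both have degree below \<open>card T\<close>. Its
  basis polynomials \<open>b t\<close> are monic of degree \<open>card T - 1\<close>, so its
  coefficient there is the sum of the \<open>c t\<close>.\<close>

lemma sum_poly_div_prod_diff_eq_coeff:
  fixes p :: "'a :: field poly"
  assumes "finite T" and "degree p < card T"
  shows "(\<Sum>t\<in>T. poly p t / (\<Prod>u\<in>T - {t}. t - u)) = coeff p (card T - 1)"
proof -
  define c where "c t = poly p t / (\<Prod>u\<in>T - {t}. t - u)" for t
  define b where "b t = (\<Prod>u\<in>T - {t}. [:- u, 1:])" for t
  define L where "L = (\<Sum>t\<in>T. smult (c t) (b t))"
  have deg_b: "degree (b t) = card T - 1" and lead_b: "coeff (b t) (card T - 1) = 1"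
    if "t \<in> T" for t
  proof -
    show *: "degree (b t) = card T - 1"
      using that assms(1) unfolding b_def by (subst degree_prod_eq_sum_degree) auto
    have "lead_coeff (b t) = 1" unfolding b_def lead_coeff_prod by simp
    then show "coeff (b t) (card T - 1) = 1" using * by simp
  qed
  have "degree L \<le> card T - 1"
    unfolding L_def using assms(1) deg_b
    by (intro degree_sum_le) (auto intro: order.trans[OF degree_smult_le])
  then have deg_L: "degree L < card T" using assms(2) by linarith
  have "poly p s = poly L s" if s: "s \<in> T" for s
  proof -
    have "poly L s = (\<Sum>t\<in>T. c t * (\<Prod>u\<in>T - {t}. s - u))"
      by (simp add: L_def b_def poly_sum poly_prod)
    also have "\<dots> = (\<Sum>t\<in>{s}. c t * (\<Prod>u\<in>T - {t}. s - u))"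
      by (rule sum.mono_neutral_right) (use s assms(1) in auto)
    also have "\<dots> = poly p s"
      using assms(1) by (simp add: c_def)
    finally show ?thesis by simp
  qed
  then have "p = L" using poly_eqI_degree[of T p L] assms(2) deg_L by blast
  then have "coeff p (card T - 1) = (\<Sum>t\<in>T. c t * coeff (b t) (card T - 1))"
    by (metis (no_types, lifting) L_def coeff_smult coeff_sum sum.cong)
  also have "\<dots> = (\<Sum>t\<in>T. c t)" using lead_b by simp
  finally show ?thesis by (simp add: c_def)
qed

text \<open>Interpolation of the monic monomial of degree \<open>card I - 1\<close> at the nodes
  \<open>x i\<close>.\<close>

lemma sum_power_div_prod_diff_eq_1:
  fixes x :: "'i \<Rightarrow> 'a :: field"
  assumes "finite I" and "inj_on x I" and "I \<noteq> {}"
  shows "(\<Sum>i\<in>I. x i ^ (card I - 1) / (\<Prod>j\<in>I - {i}. x i - x j)) = 1"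
proof -
  let ?p = "monom (1 :: 'a) (card I - 1)"
  have card: "card (x ` I) = card I" using card_image[OF assms(2)] .
  have pos: "card I > 0" using assms by (simp add: card_gt_0_iff)
  have "(\<Sum>t\<in>x ` I. poly ?p t / (\<Prod>u\<in>x ` I - {t}. t - u)) = coeff ?p (card I - 1)"
    using sum_poly_div_prod_diff_eq_coeff[of "x ` I" ?p] assms(1) card pos
      degree_monom_le[of "1 :: 'a" "card I - 1"] by simp
  also have "(\<Sum>t\<in>x ` I. poly ?p t / (\<Prod>u\<in>x ` I - {t}. t - u)) =
      (\<Sum>i\<in>I. x i ^ (card I - 1) / (\<Prod>j\<in>I - {i}. x i - x j))"
  proof (subst sum.reindex[OF assms(2)], intro sum.cong refl)
    fix i assume "i \<in> I"
    then have "x ` I - {x i} = x ` (I - {i})" using assms(2) by (auto simp: inj_on_def)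
    moreover have "inj_on x (I - {i})" using assms(2) by (auto simp: inj_on_def)
    ultimately show "((\<lambda>t. poly ?p t / (\<Prod>u\<in>x ` I - {t}. t - u)) \<circ> x) i =
        x i ^ (card I - 1) / (\<Prod>j\<in>I - {i}. x i - x j)"
      by (simp add: poly_monom prod.reindex)
  qed
  finally show ?thesis by simp
qed

section \<open>Generic points and the reflection identity\<close>

text \<open>The case \<open>i = j\<close> of the last condition excludes the values 1 and -1. For
  distinct indices it keeps inverted points distinct from the points that are not inverted.\<close>

definition generic_on :: "nat set \<Rightarrow> (nat \<Rightarrow> 'a :: field) \<Rightarrow> bool" where
  "generic_on I x \<longleftrightarrow> inj_on x I \<and> (\<forall>i\<in>I. x i \<noteq> 0) \<and> (\<forall>i\<in>I. \<forall>j\<in>I. x i * x j \<noteq> 1)"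

lemma generic_onD:
  assumes "generic_on I x" and "i \<in> I"
  shows "x i \<noteq> 0" and "1 - x i \<noteq> 0" and "1 + x i \<noteq> 0"
    and "j \<in> I \<Longrightarrow> 1 - x i * x j \<noteq> 0" and "j \<in> I \<Longrightarrow> i \<noteq> j \<Longrightarrow> x i - x j \<noteq> 0"
proof -
  have sq: "x i * x i \<noteq> 1" using assms unfolding generic_on_def by blast
  show "1 - x i \<noteq> 0" using sq by auto
  show "1 + x i \<noteq> 0"
  proof
    assume "1 + x i = 0"
    then have "x i = -1" by (simp add: add_eq_0_iff)
    then show False using sq by simp
  qed
qed (use assms in \<open>auto simp: generic_on_def inj_on_def\<close>)

lemma generic_on_subset: "generic_on I x \<Longrightarrow> J \<subseteq> I \<Longrightarrow> generic_on J x"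
  unfolding generic_on_def by (auto intro: inj_on_subset)

text \<open>Interpolate \<open>\<Prod>j\<in>S. (1 - x\<^sub>j z)\<close> at the nodes \<open>x\<^sub>i\<close> and \<open>-1\<close>.\<close>

lemma sum_prod_reflection_eq:
  fixes x :: "nat \<Rightarrow> 'a :: field"
  assumes "finite S" and "generic_on S x"
  shows "(\<Sum>i\<in>S. (1 - x i) * (\<Prod>j\<in>S - {i}. (1 - x i * x j) / (x j - x i))) = 1 - (\<Prod>i\<in>S. x i)"
proof -
  define P where "P = (\<Prod>j\<in>S. [:1, - x j:])"
  \<comment> \<open>The extra node raises \<open>card T\<close> above the degree of
    \<open>P\<close>. In the term of the node \<open>x i\<close>, its difference
    \<open>x i + 1\<close> cancels against the factor \<open>1 - x i * x i\<close> of
    \<open>P\<close>, which leaves \<open>1 - x i\<close>.\<close>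
  define T where "T = insert (-1) (x ` S)"
  have inj: "inj_on x S" using assms(2) by (simp add: generic_on_def)
  have notin: "-1 \<notin> x ` S" proof
    assume "-1 \<in> x ` S"
    then obtain i where "i \<in> S" and "x i = -1" by auto
    then show False using generic_onD(3)[OF assms(2), of i] by simp
  qed
  have card: "card T = Suc (card S)"
    using assms(1) notin card_image[OF inj] by (simp add: T_def)
  have degP: "degree P = card S"
    using generic_onD(1)[OF assms(2)] unfolding P_def by (subst degree_prod_eq_sum_degree) auto
  have "coeff P (card S) = lead_coeff P" by (simp add: degP)
  also have "\<dots> = (\<Prod>j\<in>S. - x j)"
    unfolding P_def lead_coeff_prod using generic_onD(1)[OF assms(2)]
    by (intro prod.cong) auto
  finally have leadP: "coeff P (card S) = (-1) ^ card S * (\<Prod>i\<in>S. x i)"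
    by (simp add: prod_uminus)
  have polyP: "poly P z = (\<Prod>j\<in>S. 1 - x j * z)" for z
    by (simp add: P_def poly_prod algebra_simps)
  have "(-1) ^ card S * (\<Prod>i\<in>S. x i) = (\<Sum>t\<in>T. poly P t / (\<Prod>u\<in>T - {t}. t - u))"
    using sum_poly_div_prod_diff_eq_coeff[of T P] assms(1) card degP leadP by (simp add: T_def)
  also have "\<dots> = poly P (-1) / (\<Prod>u\<in>x ` S. - 1 - u) +
      (\<Sum>t\<in>x ` S. poly P t / (\<Prod>u\<in>T - {t}. t - u))"
  proof -
    have "T - {-1} = x ` S" using notin by (auto simp: T_def)
    then show ?thesis using assms(1) notin by (simp add: T_def)
  qed
  \<comment> \<open>The numerator is the product of the \<open>1 + x j\<close>, so only the sign of
    the node differences survives.\<close>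
  also have "poly P (-1) / (\<Prod>u\<in>x ` S. - 1 - u) = (-1) ^ card S"
  proof -
    have "(\<Prod>u\<in>x ` S. - 1 - u) = (\<Prod>j\<in>S. - (1 + x j))"
      by (simp add: prod.reindex[OF inj])
    also have "\<dots> = (-1) ^ card S * (\<Prod>j\<in>S. 1 + x j)"
      by (rule prod_uminus)
    moreover have "(\<Prod>j\<in>S. 1 + x j) \<noteq> 0"
      using generic_onD(3)[OF assms(2)] assms(1) by simp
    ultimately show ?thesis by (simp add: polyP field_simps flip: power_mult_distrib)
  qed
  also have "(\<Sum>t\<in>x ` S. poly P t / (\<Prod>u\<in>T - {t}. t - u)) =
      (\<Sum>i\<in>S. - ((-1) ^ card S) * ((1 - x i) * (\<Prod>j\<in>S - {i}. (1 - x i * x j) / (x j - x i))))"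
  proof (subst sum.reindex[OF inj], intro sum.cong refl)
    fix i assume i: "i \<in> S"
    have T: "T - {x i} = insert (-1) (x ` (S - {i}))"
      using i inj notin by (auto simp: T_def inj_on_def)
    have "(\<Prod>u\<in>T - {x i}. x i - u) = (x i + 1) * (\<Prod>j\<in>S - {i}. x i - x j)"
      unfolding T using notin assms(1) inj_on_subset[OF inj, of "S - {i}"]
      by (subst prod.insert) (auto simp: prod.reindex)
    also have "(\<Prod>j\<in>S - {i}. x i - x j) = (\<Prod>j\<in>S - {i}. - (x j - x i))"
      by simp
    also have "\<dots> = (-1) ^ (card S - 1) * (\<Prod>j\<in>S - {i}. x j - x i)"
      unfolding prod_uminus using i by simp
    finally have den: "(\<Prod>u\<in>T - {x i}. x i - u) =
      (x i + 1) * ((-1) ^ (card S - 1) * (\<Prod>j\<in>S - {i}. x j - x i))" .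
    have num: "poly P (x i) = (1 + x i) * (1 - x i) * (\<Prod>j\<in>S - {i}. 1 - x i * x j)"
      using i assms(1) by (simp add: polyP prod.remove[of S i] algebra_simps)
    have sgn: "(-1) ^ card S = - ((-1 :: 'a) ^ (card S - 1))"
      using i assms(1) by (cases "card S") auto
    have a: "1 + x i \<noteq> 0" using generic_onD(3)[OF assms(2) i] .
    \<comment> \<open>The sign is its own inverse, so it can leave the denominator.\<close>
    define e where "e = (-1 :: 'a) ^ (card S - 1)"
    have e: "inverse e = e" by (simp add: e_def flip: power_inverse)
    show "((\<lambda>t. poly P t / (\<Prod>u\<in>T - {t}. t - u)) \<circ> x) i =
        - ((-1) ^ card S) * ((1 - x i) * (\<Prod>j\<in>S - {i}. (1 - x i * x j) / (x j - x i)))"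
      unfolding o_def den num sgn prod_dividef e_def[symmetric]
      using a by (simp add: divide_inverse e add.commute[of "x i" 1])
  qed
  finally have "(-1) ^ card S * (\<Prod>i\<in>S. x i) = (-1) ^ card S *
      (1 - (\<Sum>i\<in>S. (1 - x i) * (\<Prod>j\<in>S - {i}. (1 - x i * x j) / (x j - x i))))"
    unfolding sum_distrib_left[symmetric] by (simp add: right_diff_distrib)
  then show ?thesis by simp
qed

section \<open>Weights and the recursion in the exponent\<close>

definition point_weight :: "(nat \<Rightarrow> 'a :: field) \<Rightarrow> nat set \<Rightarrow> nat \<Rightarrow> 'a" where
  "point_weight x S i = (if i \<in> S then -1 else 1) / (1 - x i)"

text \<open>The cancelled form of the pair factor. It is symmetric in \<open>i\<close> and
  \<open>j\<close>, as the quotient of two antisymmetric expressions.\<close>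

definition pair_weight :: "(nat \<Rightarrow> 'a :: field) \<Rightarrow> nat set \<Rightarrow> nat \<Rightarrow> nat \<Rightarrow> 'a" where
  "pair_weight x S i j =
     (if i \<in> S \<and> j \<in> S then -1 / (1 - x i * x j)
      else if i \<in> S then 1 / (x i - x j)
      else if j \<in> S then 1 / (x j - x i)
      else 1 / (1 - x i * x j))"

text \<open>
  For \<open>i \<in> S\<close> let \<open>y\<^sub>i = 1 / x\<^sub>i\<close> and \<open>z\<^sub>i = x\<^sub>i\<close>, otherwise \<open>y\<^sub>i = x\<^sub>i\<close> and \<open>z\<^sub>i = 1\<close>. Then \<open>weight x S I\<close>
  is the product of \<open>z\<^sub>i z\<^sub>j (y\<^sub>i - y\<^sub>j) / ((x\<^sub>i - x\<^sub>j) (1 - x\<^sub>i x\<^sub>j))\<close> over all pairs and of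
  \<open>\<plusminus>1 / (1 - x\<^sub>i)\<close> over all points of \<open>I\<close>, with the minus sign for \<open>i \<in> S\<close>.
\<close>

definition weight :: "(nat \<Rightarrow> 'a :: field) \<Rightarrow> nat set \<Rightarrow> nat set \<Rightarrow> 'a" where
  "weight x S I = (\<Prod>i\<in>I. point_weight x S i) * pairs_prod (pair_weight x S) I"

definition subset_sum :: "nat \<Rightarrow> (nat \<Rightarrow> 'a :: field) \<Rightarrow> nat set \<Rightarrow> 'a" where
  "subset_sum N x I = (\<Sum>S\<in>Pow I. (\<Prod>i\<in>S. x i ^ N) * weight x S I)"

lemma pair_weight_commute: "pair_weight x S i j = pair_weight x S j i"
  by (simp add: pair_weight_def mult.commute)

lemma weight_remove:
  assumes "finite I" and "i \<in> I"
  shows "weight x S I =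
    point_weight x S i * (\<Prod>j\<in>I - {i}. pair_weight x S i j) * weight x S (I - {i})"
  unfolding weight_def
  using prod.remove[OF assms, of "point_weight x S"]
    pairs_prod_remove_commute[OF assms, of "pair_weight x S", OF pair_weight_commute]
  by (simp add: mult_ac)

text \<open>After \<open>i\<close> is deleted from \<open>I\<close>, this allows \<open>i\<close> to
  be dropped from \<open>S\<close> as well.\<close>

lemma weight_cong:
  assumes "S \<inter> I = S' \<inter> I"
  shows "weight x S I = weight x S' I"
proof -
  have "i \<in> S \<longleftrightarrow> i \<in> S'" if "i \<in> I" for i using assms that by blast
  then show ?thesis
    unfolding weight_def
    by (intro arg_cong2[where f = "(*)"] prod.cong pairs_prod_cong)
      (auto simp: point_weight_def pair_weight_def)
qed

text \<open>Among the factors of \<open>weight x S I\<close> that involve \<open>i\<close>, those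
  for \<open>j\<close> outside \<open>S\<close> are \<open>1 / (x i - x j)\<close> and cancel
  against the denominator. Those for \<open>j\<close> in \<open>S\<close>, times
  \<open>x i - x j\<close>, are the inverses of the factors on the right, and the point factor is
  \<open>-1 / (1 - x i)\<close>.\<close>

lemma weight_remove_div:
  assumes "finite I" and "generic_on I x" and "S \<subseteq> I" and "i \<in> S"
  shows "weight x S (I - {i}) / (\<Prod>j\<in>I - {i}. x i - x j) =
    - weight x S I * ((1 - x i) * (\<Prod>j\<in>S - {i}. (1 - x i * x j) / (x j - x i)))"
proof -
  have i: "i \<in> I" using assms by blast
  note gen = generic_onD[OF assms(2)]
  have "I - {i} = (S - {i}) \<union> (I - S)" using assms by auto
  then have split: "(\<Prod>j\<in>I - {i}. f j) = (\<Prod>j\<in>S - {i}. f j) * (\<Prod>j\<in>I - S. f j)" for f :: "nat \<Rightarrow> 'a"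
    using assms(1,3,4) by (simp, intro prod.union_disjoint) (auto intro: finite_subset)
  have "(\<Prod>j\<in>I - {i}. pair_weight x S i j * (x i - x j)) =
      (\<Prod>j\<in>S - {i}. pair_weight x S i j * (x i - x j)) *
      (\<Prod>j\<in>I - S. pair_weight x S i j * (x i - x j))"
    by (rule split)
  also have "(\<Prod>j\<in>I - S. pair_weight x S i j * (x i - x j)) = 1"
    using assms gen(5)[OF i] by (intro prod.neutral) (auto simp: pair_weight_def)
  also have "(\<Prod>j\<in>S - {i}. pair_weight x S i j * (x i - x j)) =
      (\<Prod>j\<in>S - {i}. inverse ((1 - x i * x j) / (x j - x i)))"
  proof -
    have "-1 / c * (a - b) = inverse (c / (b - a))" for a b c :: 'a
      by (simp add: divide_inverse right_diff_distrib mult.commute)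
    then show ?thesis using assms(4) by (intro prod.cong refl) (simp add: pair_weight_def)
  qed
  also have "\<dots> = inverse (\<Prod>j\<in>S - {i}. (1 - x i * x j) / (x j - x i))"
    by (simp only: prod_inversef[symmetric] o_def)
  finally have prods: "(\<Prod>j\<in>I - {i}. pair_weight x S i j) * (\<Prod>j\<in>I - {i}. x i - x j) =
      inverse (\<Prod>j\<in>S - {i}. (1 - x i * x j) / (x j - x i))"
    by (simp add: prod.distrib)
  define d where "d = (\<Prod>j\<in>I - {i}. x i - x j)"
  define q where "q = (\<Prod>j\<in>I - {i}. pair_weight x S i j)"
  define r where "r = (\<Prod>j\<in>S - {i}. (1 - x i * x j) / (x j - x i))"
  have d: "d \<noteq> 0" using gen(5)[OF i] assms(1) by (auto simp: d_def)
  have "j \<in> S - {i} \<Longrightarrow> (1 - x i * x j) / (x j - x i) \<noteq> 0" for j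
    using gen(4)[OF i, of j] gen(5)[of j i] i assms(3) by auto
  then have r: "r \<noteq> 0" using finite_subset[OF assms(3,1)] by (auto simp: r_def)
  have qdr: "q * d * r = 1" using prods r by (simp add: q_def d_def r_def)
  have w: "weight x S I = - (q / (1 - x i)) * weight x S (I - {i})"
    using weight_remove[OF assms(1) i, of x S] assms(4) by (simp add: point_weight_def q_def)
  have "- weight x S I * ((1 - x i) * r) = q * r * weight x S (I - {i})"
    unfolding w using gen(2)[OF i] by (simp add: field_simps)
  also have "\<dots> = weight x S (I - {i}) / d"
    using qdr d by (simp add: field_simps)
  finally show ?thesis by (simp add: d_def r_def)
qed

text \<open>Summing \<open>weight_remove_div\<close> over \<open>S\<close> leaves the reflection
  identity times \<open>- weight x S I\<close>. The left side is the change of one term of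
  \<open>subset_sum\<close> from \<open>N\<close> to \<open>Suc N\<close>, up to the power
  factor.\<close>

lemma weight_prod_diff:
  assumes "finite I" and "generic_on I x" and "S \<subseteq> I"
  shows "((\<Prod>i\<in>S. x i) - 1) * weight x S I =
    (\<Sum>i\<in>S. weight x S (I - {i}) / (\<Prod>j\<in>I - {i}. x i - x j))"
proof -
  have "(\<Sum>i\<in>S. weight x S (I - {i}) / (\<Prod>j\<in>I - {i}. x i - x j)) =
      (\<Sum>i\<in>S. - weight x S I * ((1 - x i) * (\<Prod>j\<in>S - {i}. (1 - x i * x j) / (x j - x i))))"
    by (intro sum.cong refl weight_remove_div assms)
  also have "\<dots> = - weight x S I * (1 - (\<Prod>i\<in>S. x i))"
    unfolding sum_distrib_left[symmetric]
    using sum_prod_reflection_eq[OF finite_subset[OF assms(3,1)] generic_on_subset[OF assms(2,3)]]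
    by simp
  finally show ?thesis by (simp add: algebra_simps)
qed

lemma subset_sum_Suc:
  assumes "finite I" and "generic_on I x"
  shows "subset_sum (Suc N) x I = subset_sum N x I +
    (\<Sum>i\<in>I. x i ^ N * subset_sum N x (I - {i}) / (\<Prod>j\<in>I - {i}. x i - x j))"
proof -
  let ?d = "\<lambda>i. \<Prod>j\<in>I - {i}. x i - x j"
  let ?t = "\<lambda>S i. (\<Prod>k\<in>S. x k ^ N) * (weight x S (I - {i}) / ?d i)"
  have "subset_sum (Suc N) x I - subset_sum N x I =
      (\<Sum>S\<in>Pow I. (\<Prod>i\<in>S. x i ^ N) * (((\<Prod>i\<in>S. x i) - 1) * weight x S I))"
    unfolding subset_sum_def sum_subtractf[symmetric]
    by (intro sum.cong refl) (simp add: prod.distrib algebra_simps)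
  also have "\<dots> = (\<Sum>S\<in>Pow I. \<Sum>i\<in>{i \<in> I. i \<in> S}. ?t S i)"
  proof (intro sum.cong refl)
    fix S assume S: "S \<in> Pow I"
    then have "{i \<in> I. i \<in> S} = S" by auto
    then show "(\<Prod>i\<in>S. x i ^ N) * (((\<Prod>i\<in>S. x i) - 1) * weight x S I) =
        (\<Sum>i\<in>{i \<in> I. i \<in> S}. ?t S i)"
      using weight_prod_diff[OF assms, of S] S by (simp add: sum_distrib_left)
  qed
  \<comment> \<open>With \<open>i\<close> fixed, the sets containing \<open>i\<close> are
    \<open>insert i S\<close> for \<open>S \<subseteq> I - {i}\<close>, and \<open>x i ^ N\<close>
    splits off.\<close>
  also have "\<dots> = (\<Sum>i\<in>I. \<Sum>S\<in>{S \<in> Pow I. i \<in> S}. ?t S i)"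
    by (rule sum.swap_restrict) (use assms(1) in auto)
  also have "\<dots> = (\<Sum>i\<in>I. x i ^ N * subset_sum N x (I - {i}) / ?d i)"
  proof (intro sum.cong refl)
    fix i assume i: "i \<in> I"
    have eq: "{S \<in> Pow I. i \<in> S} = insert i ` Pow (I - {i})"
    proof (intro equalityI subsetI)
      fix S assume "S \<in> {S \<in> Pow I. i \<in> S}"
      then have "S = insert i (S - {i})" and "S - {i} \<in> Pow (I - {i})" by auto
      then show "S \<in> insert i ` Pow (I - {i})" by blast
    qed (use i in auto)
    have inj: "inj_on (insert i) (Pow (I - {i}))"
      by (auto simp: inj_on_def)
    have "(\<Sum>S\<in>{S \<in> Pow I. i \<in> S}. ?t S i) = (\<Sum>S\<in>Pow (I - {i}). ?t (insert i S) i)"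
      unfolding eq by (simp add: sum.reindex[OF inj])
    also have "\<dots> = (\<Sum>S\<in>Pow (I - {i}).
        x i ^ N / ?d i * ((\<Prod>k\<in>S. x k ^ N) * weight x S (I - {i})))"
    proof (intro sum.cong refl)
      fix S assume S: "S \<in> Pow (I - {i})"
      then have "finite S" using assms(1) by (auto intro: finite_subset)
      moreover have "weight x (insert i S) (I - {i}) = weight x S (I - {i})"
        by (rule weight_cong) auto
      moreover have "i \<notin> S" using S by auto
      ultimately show "?t (insert i S) i =
          x i ^ N / ?d i * ((\<Prod>k\<in>S. x k ^ N) * weight x S (I - {i}))" by simp
    qed
    finally show "(\<Sum>S\<in>{S \<in> Pow I. i \<in> S}. ?t S i) = x i ^ N * subset_sum N x (I - {i}) / ?d i"
      by (simp add: subset_sum_def sum_distrib_left sum_divide_distrib)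
  qed
  finally show ?thesis by (simp add: algebra_simps)
qed

section \<open>Deleting an index\<close>

text \<open>Minors are indexed by initial segments again. This lemma translates between them and
  index sets with a gap; monotonicity preserves the order in pairs.\<close>

lemma subset_sum_reindex:
  assumes "strict_mono s"
  shows "subset_sum N (x \<circ> s) I = subset_sum N x (s ` I)"
proof -
  have inj: "inj_on s A" for A using strict_mono_eq[OF assms] by (auto simp: inj_on_def)
  have mem: "s i \<in> s ` S \<longleftrightarrow> i \<in> S" for i S using strict_mono_eq[OF assms] by auto
  have pair: "pair_weight (x \<circ> s) S i j = pair_weight x (s ` S) (s i) (s j)" for S i j
    unfolding pair_weight_def mem o_apply ..
  have weight: "weight (x \<circ> s) S I = weight x (s ` S) (s ` I)" for S
    unfolding weight_def pairs_prod_reindex[OF assms]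
    pair by (simp add: prod.reindex[OF inj] point_weight_def mem)
  have "inj_on ((`) s) (Pow I)" using inj[of UNIV] by (auto simp: inj_on_def inj_image_eq_iff)
  then have "(\<Sum>S\<in>Pow (s ` I). (\<Prod>i\<in>S. x i ^ N) * weight x S (s ` I)) =
      (\<Sum>S\<in>Pow I. (\<Prod>i\<in>s ` S. x i ^ N) * weight x (s ` S) (s ` I))"
    unfolding image_Pow_surj[OF refl, symmetric] by (simp add: sum.reindex)
  then show ?thesis unfolding subset_sum_def weight by (simp add: prod.reindex[OF inj])
qed

lemma strict_mono_insert_index: "strict_mono (insert_index i)"
  by (auto simp: strict_mono_def insert_index_def)

text \<open>The inverse map is \<open>delete_index i\<close>. Thus
  \<open>x \<circ> insert_index i\<close> lists the points other than \<open>x i\<close> in their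
  order.\<close>

lemma insert_index_image_lessThan:
  assumes "i < Suc n"
  shows "insert_index i ` {..<n} = {..<Suc n} - {i}"
proof (intro equalityI subsetI)
  fix j assume j: "j \<in> {..<Suc n} - {i}"
  then have "j = insert_index i (delete_index i j)" and "delete_index i j \<in> {..<n}"
    using assms by (auto simp: insert_delete_index delete_index_def)
  then show "j \<in> insert_index i ` {..<n}" by blast
qed (use assms in \<open>auto simp: insert_index_def split: if_splits\<close>)

section \<open>Vandermonde products and determinants\<close>

text \<open>The sign is that of the Schur denominator. The determinant with increasing powers is
  therefore the product at the points \<open>- x i\<close>.\<close>

definition vandermonde :: "nat \<Rightarrow> (nat \<Rightarrow> 'a :: comm_ring_1) \<Rightarrow> 'a" where
  "vandermonde n x = pairs_prod (\<lambda>i j. x i - x j) {..<n}"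

text \<open>The sign comes from the \<open>i\<close> pairs with \<open>j < i\<close>, in which
  \<open>x i\<close> is the subtracted point.\<close>

lemma vandermonde_remove:
  assumes "i < Suc n"
  shows "vandermonde (Suc n) x =
    (-1) ^ i * (\<Prod>j\<in>{..<Suc n} - {i}. x i - x j) * vandermonde n (x \<circ> insert_index i)"
proof -
  let ?f = "\<lambda>i j. x i - x j"
  have split: "{..<Suc n} - {i} = {..<i} \<union> {i<..<Suc n}" using assms by auto
  have prod_split: "prod g ({..<Suc n} - {i}) = prod g {..<i} * prod g {i<..<Suc n}"
    for g :: "nat \<Rightarrow> 'a"
    unfolding split by (rule prod.union_disjoint) auto
  have "(\<Prod>j\<in>{..<i}. ?f (min i j) (max i j)) = (\<Prod>j\<in>{..<i}. - (x i - x j))"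
    by (intro prod.cong) auto
  also have "\<dots> = (-1) ^ i * (\<Prod>j\<in>{..<i}. x i - x j)" by (simp only: prod_uminus card_lessThan)
  finally have "(\<Prod>j\<in>{..<Suc n} - {i}. ?f (min i j) (max i j)) =
      (-1) ^ i * (\<Prod>j\<in>{..<Suc n} - {i}. x i - x j)"
    unfolding prod_split by (simp add: min_def max_def)
  moreover have "pairs_prod ?f ({..<Suc n} - {i}) = vandermonde n (x \<circ> insert_index i)"
    unfolding vandermonde_def insert_index_image_lessThan[OF assms, symmetric]
      pairs_prod_reindex[OF strict_mono_insert_index] by simp
  ultimately show ?thesis
    using pairs_prod_remove[of "{..<Suc n}" i ?f] assms by (simp add: vandermonde_def)
qed

lemma vandermonde_nonzero:
  fixes x :: "nat \<Rightarrow> 'a :: field"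
  shows "inj_on x {..<n} \<Longrightarrow> vandermonde n x \<noteq> 0"
  unfolding vandermonde_def by (rule pairs_prod_nonzero) (auto simp: inj_on_def)

text \<open>The left side is the shape in which minors occur in Laplace expansions.\<close>

lemma vandermonde_remove_div:
  fixes x :: "nat \<Rightarrow> 'a :: field"
  assumes "i < Suc n" and "inj_on x {..<Suc n}"
  shows "(-1) ^ i * vandermonde n (x \<circ> insert_index i) =
    vandermonde (Suc n) x / (\<Prod>j\<in>{..<Suc n} - {i}. x i - x j)"
proof -
  have "(\<Prod>j\<in>{..<Suc n} - {i}. x i - x j) \<noteq> 0"
    using assms by (auto simp: inj_on_def)
  moreover have "(-1 :: 'a) ^ i * (-1) ^ i = 1" by (simp flip: power_mult_distrib)
  ultimately show ?thesis
    unfolding vandermonde_remove[OF assms(1), of x] by (simp add: divide_simps mult_ac)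
qed

lemma det_powers_expand_column:
  fixes x :: "nat \<Rightarrow> 'a :: comm_ring_1"
  assumes "k < Suc n"
  shows "det (mat (Suc n) (Suc n) (\<lambda>(i, j). x i ^ e j)) =
    (\<Sum>i<Suc n. (-1) ^ (i + k) * x i ^ e k *
      det (mat n n (\<lambda>(i', j). (x \<circ> insert_index i) i' ^ e (insert_index k j))))"
proof -
  let ?A = "mat (Suc n) (Suc n) (\<lambda>(i, j). x i ^ e j)"
  have "mat_delete ?A i k = mat n n (\<lambda>(i', j). (x \<circ> insert_index i) i' ^ e (insert_index k j))"
    if "i < Suc n" for i
    using that assms by (intro eq_matI) (auto simp: mat_delete_def insert_index_def)
  then show ?thesis
    by (subst laplace_expansion_column[of _ "Suc n" k])
      (use assms in \<open>auto simp: cofactor_def mult_ac intro!: sum.cong\<close>)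
qed

text \<open>Expand along the last column. By induction the minors are Vandermonde products of the
  remaining points; the full product factors out, and the remaining sum is 1 by Lagrange
  interpolation.\<close>

lemma det_powers_eq_vandermonde:
  fixes x :: "nat \<Rightarrow> 'a :: field"
  assumes "inj_on x {..<n}"
  shows "det (mat n n (\<lambda>(i, j). x i ^ j)) = vandermonde n (\<lambda>i. - x i)"
  using assms
proof (induction n arbitrary: x)
  case 0
  then show ?case by (simp add: vandermonde_def pairs_prod_def)
next
  case (Suc n)
  let ?y = "\<lambda>i. - x i"
  have inj: "inj_on ?y {..<Suc n}" using Suc.prems by (auto simp: inj_on_def)
  have "det (mat (Suc n) (Suc n) (\<lambda>(i, j). x i ^ j)) = (\<Sum>i<Suc n. (-1) ^ (i + n) * x i ^ n *
      det (mat n n (\<lambda>(i', j). (x \<circ> insert_index i) i' ^ insert_index n j)))"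
    by (rule det_powers_expand_column) simp
  also have "\<dots> = (\<Sum>i<Suc n. vandermonde (Suc n) ?y *
      (x i ^ n / (\<Prod>j\<in>{..<Suc n} - {i}. x i - x j)))"
  proof (intro sum.cong refl)
    fix i assume i: "i \<in> {..<Suc n}"
    have "inj_on (x \<circ> insert_index i) {..<n}"
      using i Suc.prems by (intro comp_inj_on insert_index_inj_on)
        (auto simp: insert_index_image_lessThan intro: inj_on_subset)
    then have "det (mat n n (\<lambda>(i', j). (x \<circ> insert_index i) i' ^ j)) =
        vandermonde n (?y \<circ> insert_index i)"
      using Suc.IH by (simp add: o_def)
    moreover have "mat n n (\<lambda>(i', j). (x \<circ> insert_index i) i' ^ insert_index n j) =
        mat n n (\<lambda>(i', j). (x \<circ> insert_index i) i' ^ j)"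
      by (intro eq_matI) auto
    ultimately have "(-1) ^ (i + n) * x i ^ n *
        det (mat n n (\<lambda>(i', j). (x \<circ> insert_index i) i' ^ insert_index n j)) =
        (-1) ^ n * x i ^ n * ((-1) ^ i * vandermonde n (?y \<circ> insert_index i))"
      by (simp add: power_add mult_ac)
    also have "\<dots> = (-1) ^ n * x i ^ n *
        (vandermonde (Suc n) ?y / (\<Prod>j\<in>{..<Suc n} - {i}. - (x i - x j)))"
      using vandermonde_remove_div[OF _ inj, of i] i by simp
    \<comment> \<open>The sign of these \<open>n\<close> factors cancels the sign of the last
      column.\<close>
    also have "(\<Prod>j\<in>{..<Suc n} - {i}. - (x i - x j)) =
        (-1) ^ n * (\<Prod>j\<in>{..<Suc n} - {i}. x i - x j)"
      unfolding prod_uminus using i by simp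
    finally show "(-1) ^ (i + n) * x i ^ n *
        det (mat n n (\<lambda>(i', j). (x \<circ> insert_index i) i' ^ insert_index n j)) =
        vandermonde (Suc n) ?y * (x i ^ n / (\<Prod>j\<in>{..<Suc n} - {i}. x i - x j))"
      by (simp add: divide_simps)
  qed
  also have "\<dots> = vandermonde (Suc n) ?y *
      (\<Sum>i<Suc n. x i ^ n / (\<Prod>j\<in>{..<Suc n} - {i}. x i - x j))"
    by (rule sum_distrib_left[symmetric])
  also have "\<dots> = vandermonde (Suc n) ?y"
    using sum_power_div_prod_diff_eq_1[of "{..<Suc n}" x] Suc.prems
    by (simp add: lessThan_empty_iff del: sum.lessThan_Suc)
  finally show ?case .
qed

text \<open>Multilinearity in the rows, read off from the Leibniz formula by expanding each product
  of sums.\<close>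

lemma det_row_binomial:
  fixes a b :: "nat \<Rightarrow> nat \<Rightarrow> 'a :: comm_ring_1"
  shows "det (mat n n (\<lambda>(i, j). a i j + b i j)) =
    (\<Sum>S\<in>Pow {..<n}. det (mat n n (\<lambda>(i, j). if i \<in> S then a i j else b i j)))"
proof -
  let ?P = "{p. p permutes {0..<n}}"
  have det_mat: "det (mat n n (\<lambda>(i, j). f i j)) = (\<Sum>p\<in>?P. signof p * (\<Prod>i<n. f i (p i)))"
    for f :: "nat \<Rightarrow> nat \<Rightarrow> 'a"
    by (subst det_def'[of _ n])
      (auto intro!: sum.cong prod.cong arg_cong2[where f = "(*)"] simp: atLeast0LessThan permutes_in_image)
  have "(\<Prod>i<n. a i (p i) + b i (p i)) =
      (\<Sum>S\<in>Pow {..<n}. \<Prod>i<n. if i \<in> S then a i (p i) else b i (p i))" for p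
  proof (subst prod_add, simp, intro sum.cong refl)
    fix S assume "S \<in> Pow {..<n}"
    then have "{..<n} \<inter> {i. i \<in> S} = S" and "{..<n} \<inter> - {i. i \<in> S} = {..<n} - S" by auto
    then show "(\<Prod>i\<in>S. a i (p i)) * (\<Prod>i\<in>{..<n} - S. b i (p i)) =
        (\<Prod>i<n. if i \<in> S then a i (p i) else b i (p i))"
      by (simp add: prod.If_cases)
  qed
  then show ?thesis
    unfolding det_mat by (simp add: sum_distrib_left sum.swap[of _ "Pow {..<n}"])
qed

lemma det_row_scale:
  fixes a :: "nat \<Rightarrow> nat \<Rightarrow> 'a :: comm_ring_1"
  shows "det (mat n n (\<lambda>(i, j). c i * a i j)) = (\<Prod>i<n. c i) * det (mat n n (\<lambda>(i, j). a i j))"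
proof -
  have "signof p * (\<Prod>i = 0..<n. mat n n (\<lambda>(i, j). c i * a i j) $$ (i, p i)) =
      (\<Prod>i<n. c i) * (signof p * (\<Prod>i = 0..<n. mat n n (\<lambda>(i, j). a i j) $$ (i, p i)))"
    if p: "p permutes {0..<n}" for p
  proof -
    have "(\<Prod>i = 0..<n. mat n n (\<lambda>(i, j). c i * a i j) $$ (i, p i)) =
        (\<Prod>i = 0..<n. c i * mat n n (\<lambda>(i, j). a i j) $$ (i, p i))"
      using permutes_in_image[OF p] by (intro prod.cong) auto
    then show ?thesis by (simp add: prod.distrib atLeast0LessThan mult_ac)
  qed
  then show ?thesis
    by (simp add: det_def'[of _ n] sum_distrib_left)
qed

text \<open>Split every row into its two powers, with \<open>S\<close> the set of rows that take the
  higher one. Each resulting determinant is a rescaled Vandermonde determinant at the points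
  \<open>y S i\<close>; the factors independent of \<open>S\<close> and \<open>N\<close> are
  collected in front.\<close>

lemma det_difference_eq:
  fixes x :: "nat \<Rightarrow> 'a :: field"
  assumes "generic_on {..<n} x"
  shows "det (mat n n (\<lambda>(i, j). x i ^ j - x i ^ (N + n - Suc j))) =
    vandermonde n (\<lambda>i. - x i) * (\<Prod>i<n. 1 - x i) *
    pairs_prod (\<lambda>i j. 1 - x i * x j) {..<n} * subset_sum N x {..<n}"
    (is "?D = ?V * ?p1 * ?p2 * _")
proof -
  note gen = generic_onD[OF assms]
  define y where "y S i = (if i \<in> S then inverse (x i) else x i)" for S i
  define z where "z S i = (if i \<in> S then x i else 1)" for S i
  have term_eq: "det (mat n n (\<lambda>(i, j). if i \<in> S then - (x i ^ (N + n - Suc j)) else x i ^ j)) =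
      ?V * ?p1 * ?p2 * ((\<Prod>i\<in>S. x i ^ N) * weight x S {..<n})"
    if S: "S \<in> Pow {..<n}" for S
  proof -
    have "inj_on (y S) {..<n}"
    proof (rule inj_onI)
      fix i j assume ij: "i \<in> {..<n}" "j \<in> {..<n}" "y S i = y S j"
      have "x i * x j \<noteq> 1" using assms ij unfolding generic_on_def by blast
      then have "x i = x j"
        using ij(3) gen(1)[OF ij(1)] gen(1)[OF ij(2)]
        by (auto simp: y_def field_simps split: if_splits)
      then show "i = j" using assms ij unfolding generic_on_def inj_on_def by blast
    qed
    then have V: "det (mat n n (\<lambda>(i, j). y S i ^ j)) = vandermonde n (\<lambda>i. - y S i)"
      by (rule det_powers_eq_vandermonde)
    \<comment> \<open>Taking out the top power turns the decreasing powers of \<open>x i\<close>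
      into increasing powers of its inverse.\<close>
    have "det (mat n n (\<lambda>(i, j). if i \<in> S then - (x i ^ (N + n - Suc j)) else x i ^ j)) =
        det (mat n n (\<lambda>(i, j). (if i \<in> S then - (x i ^ (N + n - 1)) else 1) * y S i ^ j))"
    proof (intro arg_cong[where f = det] eq_matI)
      fix i j
      assume "i < dim_row (mat n n (\<lambda>(i, j). (if i \<in> S then - (x i ^ (N + n - 1)) else 1) * y S i ^ j))"
        and "j < dim_col (mat n n (\<lambda>(i, j). (if i \<in> S then - (x i ^ (N + n - 1)) else 1) * y S i ^ j))"
      then have ij: "i < n" "j < n" by auto
      have "N + n - 1 = (N + n - Suc j) + j" using ij by simp
      then have "x i ^ (N + n - 1) = x i ^ (N + n - Suc j) * x i ^ j" by (metis power_add)
      then have "x i ^ (N + n - 1) * inverse (x i) ^ j = x i ^ (N + n - Suc j)"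
        using gen(1)[of i] ij by (simp add: field_simps)
      then show "mat n n (\<lambda>(i, j). if i \<in> S then - (x i ^ (N + n - Suc j)) else x i ^ j) $$ (i, j) =
          mat n n (\<lambda>(i, j). (if i \<in> S then - (x i ^ (N + n - 1)) else 1) * y S i ^ j) $$ (i, j)"
        using ij by (auto simp: y_def)
    qed auto
    also have "\<dots> = (\<Prod>i<n. if i \<in> S then - (x i ^ (N + n - 1)) else 1) * vandermonde n (\<lambda>i. - y S i)"
      by (simp only: det_row_scale V)
    \<comment> \<open>Three roles are separated: \<open>N\<close> carries the dependence on the
      exponent, the \<open>n - 1\<close> further copies of \<open>x i\<close> clear denominators,
      and the sign enters \<open>point_weight\<close>.\<close>
    also have "(\<Prod>i<n. if i \<in> S then - (x i ^ (N + n - 1)) else 1) =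
        (\<Prod>i<n. if i \<in> S then x i ^ N else 1) * (\<Prod>i<n. z S i ^ (n - 1)) * (\<Prod>i<n. if i \<in> S then -1 else 1)"
      unfolding prod.distrib[symmetric]
    proof (intro prod.cong refl)
      fix i assume "i \<in> {..<n}"
      then have "N + n - 1 = N + (n - 1)" by auto
      then show "(if i \<in> S then - (x i ^ (N + n - 1)) else 1) =
          (if i \<in> S then x i ^ N else 1) * z S i ^ (n - 1) * (if i \<in> S then -1 else 1)"
        by (simp add: z_def power_add)
    qed
    also have "(\<Prod>i<n. if i \<in> S then x i ^ N else 1) = (\<Prod>i\<in>S. x i ^ N)"
      using S by (simp add: prod.If_cases Int_absorb1)
    also have "(\<Prod>i<n. if i \<in> S then -1 else 1) = ?p1 * (\<Prod>i<n. point_weight x S i)"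
      unfolding prod.distrib[symmetric] using gen(2)
      by (intro prod.cong refl) (simp add: point_weight_def)
    finally have 1: "det (mat n n (\<lambda>(i, j). if i \<in> S then - (x i ^ (N + n - Suc j)) else x i ^ j)) =
        (\<Prod>i\<in>S. x i ^ N) * (?p1 * (\<Prod>i<n. point_weight x S i)) *
        ((\<Prod>i<n. z S i ^ (n - 1)) * vandermonde n (\<lambda>i. - y S i))"
      by (simp add: mult_ac)
    \<comment> \<open>Every point lies in \<open>n - 1\<close> pairs, so each pair receives
      \<open>z S i * z S j\<close>, which clears the inverses in \<open>y\<close>.\<close>
    have "(\<Prod>i<n. z S i ^ (n - 1)) * vandermonde n (\<lambda>i. - y S i) =
        pairs_prod (\<lambda>i j. z S i * z S j * (- y S i - - y S j)) {..<n}"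
      using pairs_prod_mult_points[of "{..<n}" "z S"] by (simp add: vandermonde_def pairs_prod_mult)
    also have "\<dots> = pairs_prod (\<lambda>i j. (- x i - - x j) * (1 - x i * x j) * pair_weight x S i j) {..<n}"
    proof (rule pairs_prod_cong)
      fix i j :: nat assume ij: "i \<in> {..<n}" "j \<in> {..<n}" "i < j"
      have nz: "x i \<noteq> 0" "x j \<noteq> 0" "1 - x i * x j \<noteq> 0" "x i - x j \<noteq> 0" "x j - x i \<noteq> 0"
        using gen(1)[OF ij(1)] gen(1)[OF ij(2)] gen(4)[OF ij(1,2)] gen(5)[OF ij(1,2)]
          gen(5)[OF ij(2,1)] ij(3) by auto
      have i: "x i * (x j - inverse (x i)) = - (1 - x i * x j)"
        and j: "x j * (inverse (x j) - x i) = 1 - x i * x j"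
        and b: "x i * x j * (inverse (x j) - inverse (x i)) = x i - x j"
        using nz by (simp_all add: field_simps)
      show "z S i * z S j * (- y S i - - y S j) =
          (- x i - - x j) * (1 - x i * x j) * pair_weight x S i j"
        using nz i j b by (cases "i \<in> S"; cases "j \<in> S")
          (simp_all add: y_def z_def pair_weight_def divide_simps, simp add: algebra_simps)
    qed
    finally have "(\<Prod>i<n. z S i ^ (n - 1)) * vandermonde n (\<lambda>i. - y S i) =
        ?V * ?p2 * pairs_prod (pair_weight x S) {..<n}"
      by (simp add: vandermonde_def pairs_prod_mult)
    then show ?thesis unfolding 1 weight_def by (simp add: mult_ac)
  qed
  have "?D = det (mat n n (\<lambda>(i, j). - (x i ^ (N + n - Suc j)) + x i ^ j))" by simp
  also have "\<dots> = (\<Sum>S\<in>Pow {..<n}.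
      det (mat n n (\<lambda>(i, j). if i \<in> S then - (x i ^ (N + n - Suc j)) else x i ^ j)))"
    by (rule det_row_binomial)
  also have "\<dots> = (\<Sum>S\<in>Pow {..<n}. ?V * ?p1 * ?p2 * ((\<Prod>i\<in>S. x i ^ N) * weight x S {..<n}))"
    by (intro sum.cong refl term_eq)
  also have "\<dots> = ?V * ?p1 * ?p2 * subset_sum N x {..<n}"
    unfolding subset_sum_def by (rule sum_distrib_left[symmetric])
  finally show ?thesis .
qed

section \<open>Initial values of the subset sum\<close>

lemma generic_on_comp_insert_index:
  assumes "generic_on {..<Suc n} x" and "i < Suc n"
  shows "generic_on {..<n} (x \<circ> insert_index i)"
proof -
  have gen: "generic_on (insert_index i ` {..<n}) x"
    using generic_on_subset[OF assms(1)] insert_index_image_lessThan[OF assms(2)] by auto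
  then show ?thesis
    unfolding generic_on_def by (auto intro!: comp_inj_on insert_index_inj_on)
qed

lemma subset_sum_lessThan_Suc:
  assumes "generic_on {..<Suc n} x"
  shows "subset_sum (Suc N) x {..<Suc n} = subset_sum N x {..<Suc n} +
    (\<Sum>i<Suc n. x i ^ N * subset_sum N (x \<circ> insert_index i) {..<n} /
      (\<Prod>j\<in>{..<Suc n} - {i}. x i - x j))"
  unfolding subset_sum_Suc[OF finite_lessThan assms] subset_sum_reindex[OF strict_mono_insert_index]
  by (simp add: insert_index_image_lessThan)

text \<open>For this exponent the last column of the difference determinant vanishes.\<close>

lemma subset_sum_eq_0:
  assumes "generic_on {..<Suc n} x"
  shows "subset_sum n x {..<Suc n} = 0"
proof -
  let ?A = "mat (Suc n) (Suc n) (\<lambda>(i, j). x i ^ j - x i ^ (n + Suc n - Suc j))"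
  note gen = generic_onD[OF assms]
  have "det ?A = (\<Sum>i<Suc n. ?A $$ (i, n) * cofactor ?A i n)"
    by (rule laplace_expansion_column) auto
  also have "\<dots> = 0" by (intro sum.neutral) auto
  finally have "vandermonde (Suc n) (\<lambda>i. - x i) * (\<Prod>i<Suc n. 1 - x i) *
      pairs_prod (\<lambda>i j. 1 - x i * x j) {..<Suc n} * subset_sum n x {..<Suc n} = 0"
    using det_difference_eq[OF assms, of n] by simp
  moreover have "vandermonde (Suc n) (\<lambda>i. - x i) \<noteq> 0"
    using assms by (intro vandermonde_nonzero) (simp add: generic_on_def inj_on_def)
  moreover have "(\<Prod>i<Suc n. 1 - x i) \<noteq> 0"
    using gen(2) by (simp only: prod_zero_iff finite_lessThan) blast
  moreover have "pairs_prod (\<lambda>i j. 1 - x i * x j) {..<Suc n} \<noteq> 0"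
    using gen(4) by (intro pairs_prod_nonzero) blast
  ultimately show ?thesis by (simp only: mult_eq_0_iff) blast
qed

text \<open>In the recursion from \<open>n\<close> to \<open>Suc n\<close> the first summand
  vanishes by \<open>subset_sum_eq_0\<close>, the smaller sums are 1 by induction, and what remains
  is a Lagrange sum.\<close>

lemma subset_sum_eq_1:
  assumes "generic_on {..<n} x"
  shows "subset_sum n x {..<n} = 1"
  using assms
proof (induction n arbitrary: x)
  case 0
  then show ?case by (simp add: subset_sum_def weight_def pairs_prod_def)
next
  case (Suc n)
  have "subset_sum (Suc n) x {..<Suc n} =
      (\<Sum>i<Suc n. x i ^ n / (\<Prod>j\<in>{..<Suc n} - {i}. x i - x j))"
    unfolding subset_sum_lessThan_Suc[OF Suc.prems] subset_sum_eq_0[OF Suc.prems] add_0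
    by (intro sum.cong refl)
      (simp add: Suc.IH[OF generic_on_comp_insert_index[OF Suc.prems]])
  also have "\<dots> = 1"
    using sum_power_div_prod_diff_eq_1[of "{..<Suc n}" x] Suc.prems
    by (simp add: generic_on_def lessThan_empty_iff del: sum.lessThan_Suc)
  finally show ?case .
qed

section \<open>The sum of the alternants\<close>

text \<open>The sum of the numerators of the Schur functions. Indices start at 0, hence
  \<open>Suc j\<close> in the exponent.\<close>

definition alternant_sum :: "nat \<Rightarrow> nat \<Rightarrow> (nat \<Rightarrow> 'a :: comm_ring_1) \<Rightarrow> 'a" where
  "alternant_sum m n x =
     (\<Sum>lam\<in>box_partitions m n. det (mat n n (\<lambda>(i, j). x i ^ (lam ! j + n - Suc j))))"

lemma finite_box_partitions: "finite (box_partitions m n)"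
  by (rule finite_subset[OF _ finite_lists_length_eq[of "{..m}" n]]) (auto simp: box_partitions_def)

lemma box_partitions_0: "box_partitions m 0 = {[]}"
  by (auto simp: box_partitions_def)

lemma box_partitions_0_Suc: "box_partitions 0 (Suc n) = (#) 0 ` box_partitions 0 n"
  by (auto simp: box_partitions_def length_Suc_conv image_iff)

text \<open>The second set consists of the partitions whose largest part is exactly
  \<open>Suc m\<close>; the other parts are still bounded only by \<open>Suc m\<close>.\<close>

lemma box_partitions_Suc_Suc:
  "box_partitions (Suc m) (Suc n) =
     box_partitions m (Suc n) \<union> (#) (Suc m) ` box_partitions (Suc m) n"
proof (intro equalityI subsetI)
  fix lam assume lam: "lam \<in> box_partitions (Suc m) (Suc n)"
  then obtain k ks where ks: "lam = k # ks" by (auto simp: box_partitions_def length_Suc_conv)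
  show "lam \<in> box_partitions m (Suc n) \<union> (#) (Suc m) ` box_partitions (Suc m) n"
  proof (cases "k = Suc m")
    case True
    then show ?thesis using lam ks by (auto simp: box_partitions_def)
  next
    case False
    then show ?thesis using lam ks by (fastforce simp: box_partitions_def)
  qed
qed (auto simp: box_partitions_def)

text \<open>The first column has the constant exponent \<open>m + n\<close>. Deleting it together
  with row \<open>i\<close> leaves the alternant of the other parts in the other variables.\<close>

lemma alternant_sum_Cons:
  "(\<Sum>lam\<in>(#) m ` box_partitions m n.
      det (mat (Suc n) (Suc n) (\<lambda>(i, j). x i ^ (lam ! j + Suc n - Suc j)))) =
    (\<Sum>i<Suc n. (-1) ^ i * x i ^ (m + n) * alternant_sum m n (x \<circ> insert_index i))"
proof -
  have "det (mat (Suc n) (Suc n) (\<lambda>(i, j). x i ^ ((m # lam) ! j + Suc n - Suc j))) =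
      (\<Sum>i<Suc n. (-1) ^ i * x i ^ (m + n) *
        det (mat n n (\<lambda>(i', j). (x \<circ> insert_index i) i' ^ (lam ! j + n - Suc j))))" for lam
    using det_powers_expand_column[of 0 n x "\<lambda>j. (m # lam) ! j + Suc n - Suc j"]
    by (simp del: sum.lessThan_Suc)
  then show ?thesis
    unfolding alternant_sum_def sum_distrib_left
    by (simp add: sum.reindex del: sum.lessThan_Suc) (rule sum.swap)
qed

text \<open>Outer induction on the number of variables, for all \<open>m\<close> and
  \<open>x\<close>, and inner induction on \<open>m\<close>: both sides have the same increments and
  the same value at \<open>m = 0\<close>.\<close>

lemma alternant_sum_eq:
  fixes x :: "nat \<Rightarrow> 'a :: field"
  assumes "generic_on {..<n} x"
  shows "alternant_sum m n x = vandermonde n x * subset_sum (m + n) x {..<n}"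
  using assms
proof (induction n arbitrary: m x)
  case 0
  then show ?case
    by (simp add: alternant_sum_def box_partitions_0 vandermonde_def subset_sum_def weight_def
        pairs_prod_def)
next
  case (Suc n)
  have inj: "inj_on x {..<Suc n}" using Suc.prems by (simp add: generic_on_def)
  \<comment> \<open>Partitions with first part \<open>m\<close> account for exactly one step of the
    recursion of \<open>subset_sum\<close>, from \<open>m + n\<close> to
    \<open>m + Suc n\<close>.\<close>
  have top: "(\<Sum>lam\<in>(#) m ` box_partitions m n.
      det (mat (Suc n) (Suc n) (\<lambda>(i, j). x i ^ (lam ! j + Suc n - Suc j)))) =
    vandermonde (Suc n) x *
      (subset_sum (m + Suc n) x {..<Suc n} - subset_sum (m + n) x {..<Suc n})" for m
  proof -
    have "(\<Sum>lam\<in>(#) m ` box_partitions m n.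
        det (mat (Suc n) (Suc n) (\<lambda>(i, j). x i ^ (lam ! j + Suc n - Suc j)))) =
      (\<Sum>i<Suc n. vandermonde (Suc n) x *
        (x i ^ (m + n) * subset_sum (m + n) (x \<circ> insert_index i) {..<n} /
          (\<Prod>j\<in>{..<Suc n} - {i}. x i - x j)))"
      unfolding alternant_sum_Cons
    proof (intro sum.cong refl)
      fix i assume i: "i \<in> {..<Suc n}"
      then have "alternant_sum m n (x \<circ> insert_index i) = vandermonde n (x \<circ> insert_index i) *
          subset_sum (m + n) (x \<circ> insert_index i) {..<n}"
        by (intro Suc.IH generic_on_comp_insert_index[OF Suc.prems]) simp
      then have "(-1) ^ i * x i ^ (m + n) * alternant_sum m n (x \<circ> insert_index i) =
          x i ^ (m + n) * subset_sum (m + n) (x \<circ> insert_index i) {..<n} *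
          ((-1) ^ i * vandermonde n (x \<circ> insert_index i))"
        by (simp add: mult_ac)
      also have "(-1) ^ i * vandermonde n (x \<circ> insert_index i) =
          vandermonde (Suc n) x / (\<Prod>j\<in>{..<Suc n} - {i}. x i - x j)"
        using vandermonde_remove_div[OF _ inj] i by simp
      finally show "(-1) ^ i * x i ^ (m + n) * alternant_sum m n (x \<circ> insert_index i) =
          vandermonde (Suc n) x *
          (x i ^ (m + n) * subset_sum (m + n) (x \<circ> insert_index i) {..<n} /
            (\<Prod>j\<in>{..<Suc n} - {i}. x i - x j))"
        by (simp add: mult_ac o_def)
    qed
    then show ?thesis
      using subset_sum_lessThan_Suc[OF Suc.prems, of "m + n"]
      by (simp add: sum_distrib_left del: sum.lessThan_Suc)
  qed
  show ?case
  proof (induction m)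
    case 0
    \<comment> \<open>Here every partition has first part 0, and the telescoping starts at the value
      0 of \<open>subset_sum n\<close>.\<close>
    then show ?case
      using top[of 0] subset_sum_eq_0[OF Suc.prems]
      by (simp add: alternant_sum_def box_partitions_0_Suc)
  next
    case (Suc m)
    have "alternant_sum (Suc m) (Suc n) x = alternant_sum m (Suc n) x +
        (\<Sum>lam\<in>(#) (Suc m) ` box_partitions (Suc m) n.
          det (mat (Suc n) (Suc n) (\<lambda>(i, j). x i ^ (lam ! j + Suc n - Suc j))))"
      unfolding alternant_sum_def box_partitions_Suc_Suc
      by (rule sum.union_disjoint) (auto simp: finite_box_partitions, auto simp: box_partitions_def)
    then show ?case unfolding Suc.IH top by (simp add: algebra_simps)
  qed
qed

section \<open>The identity at generic points and for the variables\<close>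

text \<open>Numerator and denominator are the difference determinant for \<open>N = m + n\<close>
  and \<open>N = n\<close>. Their common factor cancels, and the second subset sum is 1.\<close>

lemma sum_schur_box_partitions:
  fixes x :: "nat \<Rightarrow> 'a :: field"
  assumes "generic_on {1..n} x"
  shows "(\<Sum>lam \<in> box_partitions m n. schur n x lam) =
    det1 n (\<lambda>i j. x i ^ (j - 1) - x i ^ (m + 2 * n - j)) /
    det1 n (\<lambda>i j. x i ^ (j - 1) - x i ^ (2 * n - j))"
proof -
  \<comment> \<open>The shift from indices starting at 1 to indices starting at 0.\<close>
  define y where "y = x \<circ> Suc"
  have Suc_image: "Suc ` {..<n} = {1..n}" by (auto simp: image_Suc_lessThan)
  have gen: "generic_on {..<n} y"
    using assms unfolding generic_on_def y_def Suc_image[symmetric]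
    by (auto intro!: comp_inj_on)
  have inj: "inj_on y {..<n}" using gen by (simp add: generic_on_def)
  have "{(i, j). 1 \<le> i \<and> i < j \<and> j \<le> n} = {(i, j). i \<in> {1..n} \<and> j \<in> {1..n} \<and> i < j}" by auto
  then have den: "(\<Prod>(i, j) \<in> {(i, j). 1 \<le> i \<and> i < j \<and> j \<le> n}. x i - x j) = vandermonde n y"
    using pairs_prod_reindex[of Suc "\<lambda>i j. x i - x j" "{..<n}"]
    by (simp add: vandermonde_def pairs_prod_def y_def Suc_image strict_mono_def)
  have "(\<Sum>lam \<in> box_partitions m n. schur n x lam) = alternant_sum m n y / vandermonde n y"
    unfolding schur_def den alternant_sum_def sum_divide_distrib det1_def
    by (simp add: part_def y_def)
  also have "\<dots> = subset_sum (m + n) y {..<n}"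
    using alternant_sum_eq[OF gen, of m] vandermonde_nonzero[OF inj] by simp
  finally have lhs: "(\<Sum>lam \<in> box_partitions m n. schur n x lam) = subset_sum (m + n) y {..<n}" .
  have det: "det1 n (\<lambda>i j. x i ^ (j - 1) - x i ^ (N + n - j)) =
      vandermonde n (\<lambda>i. - y i) * (\<Prod>i<n. 1 - y i) *
      pairs_prod (\<lambda>i j. 1 - y i * y j) {..<n} * subset_sum N y {..<n}" (is "_ = ?E * _") for N
    using det_difference_eq[OF gen, of N] by (simp add: det1_def y_def)
  have "vandermonde n (\<lambda>i. - y i) \<noteq> 0"
    using inj by (intro vandermonde_nonzero) (simp add: inj_on_def)
  moreover have "(\<Prod>i<n. 1 - y i) \<noteq> 0"
    using generic_onD(2)[OF gen] by (simp only: prod_zero_iff finite_lessThan) blast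
  moreover have "pairs_prod (\<lambda>i j. 1 - y i * y j) {..<n} \<noteq> 0"
    using generic_onD(4)[OF gen] by (intro pairs_prod_nonzero) blast
  ultimately have "?E \<noteq> 0" by simp
  then show ?thesis
    using det[of "m + n"] det[of n] subset_sum_eq_1[OF gen] lhs
    by (simp add: mult_2 add.assoc)
qed

lemma X_inj: "X i = X j \<Longrightarrow> i = j"
proof -
  assume "X i = X j"
  then have "Poly_Mapping.single (Poly_Mapping.single i (1 :: nat)) (1 :: rat) =
      Poly_Mapping.single (Poly_Mapping.single j 1) 1"
    by (simp add: X_def eq_fract)
  then have "Poly_Mapping.single i (1 :: nat) = Poly_Mapping.single j 1"
    by (metis lookup_single_eq lookup_single_not_eq one_neq_zero)
  then show "i = j" by (metis lookup_single_eq lookup_single_not_eq one_neq_zero)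
qed

lemma X_nonzero: "X i \<noteq> 0"
proof
  assume "X i = 0"
  then have "Poly_Mapping.single (Poly_Mapping.single i (1 :: nat)) (1 :: rat) = 0"
    by (simp add: X_def Zero_fract_def eq_fract)
  then show False by (metis lookup_single_eq lookup_zero one_neq_zero)
qed

text \<open>The product is a monomial whose exponent at \<open>i\<close> is positive, also for
  \<open>i = j\<close>, whereas 1 is the monomial with exponent 0.\<close>

lemma X_mult_X_neq_1: "X i * X j \<noteq> 1"
proof
  assume "X i * X j = 1"
  then have "Poly_Mapping.single (Poly_Mapping.single i (1 :: nat) + Poly_Mapping.single j 1) (1 :: rat) = 1"
    by (simp add: X_def One_fract_def eq_fract mult_single)
  also have "(1 :: (nat \<Rightarrow>\<^sub>0 nat) \<Rightarrow>\<^sub>0 rat) = Poly_Mapping.single 0 1" by simp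
  finally have "Poly_Mapping.single i (1 :: nat) + Poly_Mapping.single j 1 = 0"
    by (metis lookup_single_eq lookup_single_not_eq one_neq_zero)
  then have "Poly_Mapping.lookup (Poly_Mapping.single i (1 :: nat) + Poly_Mapping.single j 1) i = 0"
    by simp
  then show False by (simp add: lookup_add)
qed

theorem mainTheorem1:
  fixes m n :: nat
  assumes "m \<ge> 1" and "n \<ge> 1"
  shows "(\<Sum>lam \<in> box_partitions m n. schur n X lam) =
    det1 n (\<lambda>i j. X i ^ (j - 1) - X i ^ (m + 2 * n - j)) /
    det1 n (\<lambda>i j. X i ^ (j - 1) - X i ^ (2 * n - j))"
  \<comment> \<open>The variables are generic: they are distinct, nonzero, and no product of two of
    them is 1.\<close>
  by (rule sum_schur_box_partitions)
    (auto simp: generic_on_def inj_on_def X_nonzero X_mult_X_neq_1 dest: X_inj)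

end
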